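(* Let $x$ and $y$ be positive left-computable numbers with $x\leq_S y$ (i.e. $x$ is Solovay reducible to $y$). If $y$ is reordered computable, then $x$ is reordered computable as well.
   Context: $\mathbb{N}=\{0,1,2,\dots\}$. A real number is left-computable if some computable strictly increasing sequence of rational numbers converges to it. For left-computable numbers $x,y$, $x$ is Solovay reducible to $y$, written $x\le_S y$, if there exist computable strictly increasing sequences of rational numbers $(x_n)_n$ and $(y_n)_n$ converging to $x$ and $y$, respectively, and a constant $c>0$ with $x-x_n\le c\cdot(y-y_n)$ for all $n\in\mathbb{N}$. A function $f\colon\mathbb{N}\to\mathbb{N}$ tends to infinity if for every $c$ there is $m$ with $f(n)>c$ for all $n\ge m$. For such $f$, $u_f(n) := |\{k\in\mathbb{N} \mid f(k)=n\}|$. A function $f\colon\mathbb{N}\to\mathbb{N}$ is a name for a real number $x$ if $\sum_{k=0}^\infty 2^{-f(k)} = x$ (then $f$ tends to infinity). A convergent sequence $(x_n)_n$ with limit $x$ converges computably if there is a computable $s\colon\mathbb{N}\to\mathbb{N}$ with $|x-x_k|\le 2^{-n}$ for all $n$ and all $k\ge s(n)$; a series converges computably if the sequence of its partial sums $\left(\sum_{k=0}^{n-1}a_k\right)_n$ does (no computability of the terms is required). A real number is reordered computable if it has a computable name $f$ such that $\sum_{k=0}^\infty u_f(k)\cdot 2^{-k}$ converges computably. *)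

theory Defs
  imports Complex_Main
begin

text \<open>
  \<open>recursive_fn n f\<close>: on argument lists of length \<open>n\<close>, \<open>f\<close> is a (total, general) recursive function
  of \<open>n\<close> arguments, i.e. it is generated from the initial functions by composition, primitive
  recursion and minimization of regular functions. Values of \<open>f\<close> on lists of any other length are
  irrelevant. Since minimization is only applied where a zero always exists, all functions are
  total; by Kleene's normal form theorem these are exactly the total computable functions.
\<close>

inductive recursive_fn :: "nat \<Rightarrow> (nat list \<Rightarrow> nat) \<Rightarrow> bool" where
  zero: "recursive_fn n (\<lambda>xs. 0)"
| succ: "recursive_fn 1 (\<lambda>xs. Suc (xs ! 0))"
| proj: "i < n \<Longrightarrow> recursive_fn n (\<lambda>xs. xs ! i)"
| comp: "recursive_fn (length hs) g \<Longrightarrow> \<forall>h\<in>set hs. recursive_fn n h \<Longrightarrow>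
    recursive_fn n (\<lambda>xs. g (map (\<lambda>h. h xs) hs))"
| prim_rec: "recursive_fn n g \<Longrightarrow> recursive_fn (Suc (Suc n)) h \<Longrightarrow>
    recursive_fn (Suc n) (\<lambda>xs. rec_nat (g (tl xs)) (\<lambda>k r. h (k # r # tl xs)) (hd xs))"
| minim: "recursive_fn (Suc n) g \<Longrightarrow> \<forall>xs. length xs = n \<longrightarrow> (\<exists>k. g (k # xs) = 0) \<Longrightarrow>
    recursive_fn n (\<lambda>xs. LEAST k. g (k # xs) = 0)"

definition computable :: "(nat \<Rightarrow> nat) \<Rightarrow> bool" where
  "computable f \<longleftrightarrow> (\<exists>g. recursive_fn 1 g \<and> (\<forall>n. f n = g [n]))"

definition computable_rat_seq :: "(nat \<Rightarrow> rat) \<Rightarrow> bool" where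
  "computable_rat_seq q \<longleftrightarrow>
    (\<exists>a b d. computable a \<and> computable b \<and> computable d \<and>
      (\<forall>n. d n > 0 \<and> q n = (of_nat (a n) - of_nat (b n)) / of_nat (d n)))"

definition left_approx :: "(nat \<Rightarrow> rat) \<Rightarrow> real \<Rightarrow> bool" where
  "left_approx q x \<longleftrightarrow>
    computable_rat_seq q \<and> strict_mono q \<and> (\<lambda>n. real_of_rat (q n)) \<longlonglongrightarrow> x"

definition left_computable :: "real \<Rightarrow> bool" where
  "left_computable x \<longleftrightarrow> (\<exists>q. left_approx q x)"

definition solovay_reducible :: "real \<Rightarrow> real \<Rightarrow> bool"  (infix \<open>\<le>\<^sub>S\<close> 50) where
  "x \<le>\<^sub>S y \<longleftrightarrow>
    (\<exists>p q. left_approx p x \<and> left_approx q y \<and>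
      (\<exists>c::real. c > 0 \<and> (\<forall>n. x - real_of_rat (p n) \<le> c * (y - real_of_rat (q n)))))"

text \<open>
  If \<open>f\<close> is a name for some real number, then \<open>f\<close> tends to infinity, so all the sets counted by
  \<open>multiplicity_fn f\<close> are finite and \<open>card\<close> is their true cardinality.
\<close>

definition is_name :: "(nat \<Rightarrow> nat) \<Rightarrow> real \<Rightarrow> bool" where
  "is_name f x \<longleftrightarrow> (\<lambda>k. 1 / 2 ^ f k) sums x"

definition multiplicity_fn :: "(nat \<Rightarrow> nat) \<Rightarrow> nat \<Rightarrow> nat" where
  "multiplicity_fn f n = card {k. f k = n}"

definition converges_computably :: "(nat \<Rightarrow> real) \<Rightarrow> bool" where
  "converges_computably X \<longleftrightarrow>
    (\<exists>x. X \<longlonglongrightarrow> x \<and>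
      (\<exists>s. computable s \<and> (\<forall>n. \<forall>k\<ge>s n. \<bar>x - X k\<bar> \<le> 1 / 2 ^ n)))"

definition series_converges_computably :: "(nat \<Rightarrow> real) \<Rightarrow> bool" where
  "series_converges_computably a \<longleftrightarrow> converges_computably (\<lambda>n. \<Sum>k<n. a k)"

definition reordered_computable :: "real \<Rightarrow> bool" where
  "reordered_computable x \<longleftrightarrow>
    (\<exists>f. computable f \<and> is_name f x \<and>
      series_converges_computably (\<lambda>k. real (multiplicity_fn f k) * (1 / 2 ^ k)))"

end

theory Submission imports Defs begin

text \<open>
  Let \<open>f\<close> be a computable name of \<open>y\<close>. That the reordered series of \<open>f\<close> converges computably means
  that one can compute, for each \<open>n\<close>, a level \<open>s n\<close> such that the terms of size at most
  \<open>2^-(s n)\<close> add up to at most \<open>2^-n\<close> (\<open>tail_modulus\<close>). The goal is a computable name \<open>g\<close> of \<open>x\<close>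
  with the same property.

  Reordered computability is preserved under doubling, since every term can be listed twice.
  So \<open>x\<close> may be replaced by \<open>x / 2^e\<close>, and the reduction then has constant \<open>1/2\<close>: with
  \<open>Y t\<close> the sum of the first \<open>t\<close> terms of \<open>y\<close>, there is a computable nondecreasing sequence of lower
  bounds \<open>\<xi> t < x\<close> with \<open>x - \<xi> t \<le> (y - Y (t + 1)) / 2\<close>, obtained by waiting until the given
  approximation of \<open>y\<close> has passed \<open>Y (t + 1)\<close>.

  The terms of \<open>y\<close> serve as a budget for \<open>x\<close>. Spending the term \<open>2^-f(t)\<close> only at time \<open>t\<close> does not
  work: the best power of two below the remaining gap can be much smaller than the budget, and
  what is not spent is lost. Instead the term is poured into a reservoir, and at every time half of
  the reservoir is paid out; the payout at time \<open>t\<close> equals what is left, namely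
  \<open>r (t + 1) = (r t + 2^-f(t)) / 2\<close>. The number \<open>g t\<close> is chosen minimal such that \<open>2^-g(t)\<close> is at most
  this payout and adding it to the sum \<open>G t\<close> built so far stays below \<open>\<xi> t\<close>. Then
  \<open>x - G t \<le> (y - Y t + r t) / 2\<close> is an invariant (\<open>greedy_name\<close>): either more than half of the payout
  is used, or minimality of \<open>g t\<close> says that \<open>G (t + 1)\<close> misses \<open>\<xi> t\<close> by at most \<open>2^-g(t)\<close>, which is
  covered by half of the reservoir that remains. Hence \<open>g\<close> is a name of \<open>x\<close>.

  The small terms of \<open>g\<close> are bounded because \<open>2^-g(t) \<le> r (t + 1)\<close> and \<open>r (t + 1)\<close> is the
  sum of the contributions \<open>2^-f(i) / 2^(j + 1)\<close> of the terms \<open>i = t - j\<close>. Truncated at \<open>2^-K\<close>,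
  the contributions of one \<open>i\<close> over all times add up to at most \<open>2^-f(i)\<close>, which is enough for the
  small terms of \<open>f\<close>, and to at most \<open>(K + 1) 2^-K\<close>, which for large \<open>K\<close> is enough for the others
  (\<open>tail_modulus_if_below_reservoir\<close>).
\<close>

section \<open>Closure properties of recursive functions\<close>

text \<open>
  Values on argument lists of other lengths are ignored, so that a function may be given by any
  convenient expression such as \<open>\<lambda>xs. xs ! 0 + xs ! 1\<close>.
\<close>

definition computable_nary :: "nat \<Rightarrow> (nat list \<Rightarrow> nat) \<Rightarrow> bool" where
  "computable_nary n f \<longleftrightarrow> (\<exists>g. recursive_fn n g \<and> (\<forall>xs. length xs = n \<longrightarrow> f xs = g xs))"

text \<open>
  Truth is coded by \<open>0\<close>, the value that minimization searches for.
\<close>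

definition decidable_nary :: "nat \<Rightarrow> (nat list \<Rightarrow> bool) \<Rightarrow> bool" where
  "decidable_nary n P \<longleftrightarrow> computable_nary n (\<lambda>xs. if P xs then 0 else 1)"

lemma computable_naryI: "recursive_fn n g \<Longrightarrow> (\<And>xs. length xs = n \<Longrightarrow> f xs = g xs) \<Longrightarrow> computable_nary n f"
  unfolding computable_nary_def by blast

lemma computable_nary_cong:
  "computable_nary n f \<Longrightarrow> (\<And>xs. length xs = n \<Longrightarrow> f' xs = f xs) \<Longrightarrow> computable_nary n f'"
  unfolding computable_nary_def by metis

lemma computable_iff_nary: "computable f \<longleftrightarrow> computable_nary 1 (\<lambda>xs. f (xs ! 0))"
proof -
  have "(\<forall>n. f n = g [n]) \<longleftrightarrow> (\<forall>xs. length xs = 1 \<longrightarrow> f (xs ! 0) = g xs)" for g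
    by (auto simp: length_Suc_conv)
  then show ?thesis
    unfolding computable_def computable_nary_def by simp
qed

lemma computable_nary_comp:
  assumes "computable_nary (length hs) g" and "\<forall>h\<in>set hs. computable_nary n h"
  shows "computable_nary n (\<lambda>xs. g (map (\<lambda>h. h xs) hs))"
proof -
  obtain g' where g': "recursive_fn (length hs) g'" "\<And>xs. length xs = length hs \<Longrightarrow> g xs = g' xs"
    using assms(1) unfolding computable_nary_def by blast
  have "\<exists>h'. recursive_fn n h' \<and> (\<forall>xs. length xs = n \<longrightarrow> h xs = h' xs)" if "h \<in> set hs" for h
    using that assms(2) unfolding computable_nary_def by blast
  then obtain F where F: "\<And>h. h \<in> set hs \<Longrightarrow> recursive_fn n (F h)"
      "\<And>h xs. h \<in> set hs \<Longrightarrow> length xs = n \<Longrightarrow> h xs = F h xs"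
    by metis
  have "recursive_fn n (\<lambda>xs. g' (map (\<lambda>h. h xs) (map F hs)))"
    by (rule recursive_fn.comp) (use g' F in auto)
  then show ?thesis
  proof (rule computable_naryI)
    fix xs :: "nat list" assume "length xs = n"
    then have "map (\<lambda>h. h xs) hs = map (\<lambda>h. h xs) (map F hs)" using F(2) by simp
    then show "g (map (\<lambda>h. h xs) hs) = g' (map (\<lambda>h. h xs) (map F hs))"
      using g'(2)[of "map (\<lambda>h. h xs) hs"] by (metis length_map)
  qed
qed

lemma computable_nary_comp1:
  assumes "computable_nary 1 (\<lambda>xs. \<phi> (xs ! 0))" and "computable_nary n f"
  shows "computable_nary n (\<lambda>xs. \<phi> (f xs))"
  using computable_nary_comp[of "[f]" "\<lambda>xs. \<phi> (xs ! 0)" n] assms by simp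

lemma computable_nary_comp2:
  assumes "computable_nary 2 (\<lambda>xs. \<phi> (xs ! 0) (xs ! 1))"
    and "computable_nary n f" and "computable_nary n g"
  shows "computable_nary n (\<lambda>xs. \<phi> (f xs) (g xs))"
  using computable_nary_comp[of "[f, g]" "\<lambda>xs. \<phi> (xs ! 0) (xs ! 1)" n] assms
  by (simp add: numeral_2_eq_2)

lemma computable_nary_computable:
  assumes "computable \<phi>" and "computable_nary n f"
  shows "computable_nary n (\<lambda>xs. \<phi> (f xs))"
  using assms computable_nary_comp1 computable_iff_nary by blast

lemma computable_nary_proj: "i < n \<Longrightarrow> computable_nary n (\<lambda>xs. xs ! i)"
  by (rule computable_naryI[OF recursive_fn.proj]) auto

lemma computable_nary_Suc: "computable_nary n f \<Longrightarrow> computable_nary n (\<lambda>xs. Suc (f xs))"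
  by (rule computable_nary_comp1[of Suc]) (rule computable_naryI[OF recursive_fn.succ], simp)

lemma computable_nary_const: "computable_nary n (\<lambda>xs. c)"
proof (induction c)
  case 0
  then show ?case by (rule computable_naryI[OF recursive_fn.zero]) auto
next
  case (Suc c)
  then show ?case by (rule computable_nary_Suc)
qed

text \<open>
  The recursion and minimization rules below are stated for curried functions of few arguments,
  because then they apply to defining expressions by unification.
\<close>

lemma computable_nary_rec1:
  assumes "computable_nary 2 (\<lambda>xs. h (xs ! 0) (xs ! 1))"
  shows "computable_nary 1 (\<lambda>xs. rec_nat c h (xs ! 0))"
proof -
  obtain h' where h': "recursive_fn 2 h'" "\<And>xs. length xs = 2 \<Longrightarrow> h (xs ! 0) (xs ! 1) = h' xs"
    using assms unfolding computable_nary_def by blast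
  obtain c' where c': "recursive_fn 0 c'" "c' [] = c"
    using computable_nary_const[of 0 c] unfolding computable_nary_def by auto
  have "h = (\<lambda>k r. h' [k, r])"
    using h'(2)[of "[k, r]" for k r] by (intro ext) simp
  moreover have "recursive_fn (Suc 0) (\<lambda>xs. rec_nat (c' (tl xs)) (\<lambda>k r. h' (k # r # tl xs)) (hd xs))"
    by (rule recursive_fn.prim_rec) (use h' c' in \<open>auto simp: numeral_2_eq_2\<close>)
  ultimately show ?thesis
    using c'(2)
    by (intro computable_naryI[where g = "\<lambda>xs. rec_nat (c' (tl xs)) (\<lambda>k r. h' (k # r # tl xs)) (hd xs)"])
      (auto simp: length_Suc_conv)
qed

lemma computable_nary_rec2:
  assumes "computable_nary 1 (\<lambda>xs. g (xs ! 0))"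
    and "computable_nary 3 (\<lambda>xs. h (xs ! 0) (xs ! 1) (xs ! 2))"
  shows "computable_nary 2 (\<lambda>xs. rec_nat (g (xs ! 1)) (\<lambda>k r. h k r (xs ! 1)) (xs ! 0))"
proof -
  obtain h' where h': "recursive_fn 3 h'"
      "\<And>xs. length xs = 3 \<Longrightarrow> h (xs ! 0) (xs ! 1) (xs ! 2) = h' xs"
    using assms(2) unfolding computable_nary_def by blast
  obtain g' where g': "recursive_fn 1 g'" "\<And>xs. length xs = 1 \<Longrightarrow> g (xs ! 0) = g' xs"
    using assms(1) unfolding computable_nary_def by blast
  have "h = (\<lambda>k r a. h' [k, r, a])"
    using h'(2)[of "[k, r, a]" for k r a] by (intro ext) simp
  moreover have "g = (\<lambda>a. g' [a])"
    using g'(2)[of "[a]" for a] by (intro ext) simp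
  moreover have "recursive_fn (Suc 1) (\<lambda>xs. rec_nat (g' (tl xs)) (\<lambda>k r. h' (k # r # tl xs)) (hd xs))"
    by (rule recursive_fn.prim_rec) (use h' g' in \<open>auto simp: numeral_3_eq_3\<close>)
  ultimately show ?thesis
    by (intro computable_naryI[where g = "\<lambda>xs. rec_nat (g' (tl xs)) (\<lambda>k r. h' (k # r # tl xs)) (hd xs)"])
      (auto simp: length_Suc_conv numeral_2_eq_2)
qed

lemma computable_nary_Least:
  assumes "decidable_nary (Suc n) (\<lambda>xs. P (hd xs) (tl xs))" and ex: "\<And>xs. length xs = n \<Longrightarrow> \<exists>k. P k xs"
  shows "computable_nary n (\<lambda>xs. LEAST k. P k xs)"
proof -
  obtain g where g: "recursive_fn (Suc n) g"
      "\<And>xs. length xs = Suc n \<Longrightarrow> (if P (hd xs) (tl xs) then 0 else 1) = g xs"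
    using assms(1) unfolding decidable_nary_def computable_nary_def by blast
  have *: "g (k # xs) = 0 \<longleftrightarrow> P k xs" if "length xs = n" for k xs
    using g(2)[of "k # xs"] that by (auto split: if_splits)
  have "recursive_fn n (\<lambda>xs. LEAST k. g (k # xs) = 0)"
    by (rule recursive_fn.minim) (use g * ex in auto)
  then show ?thesis
    by (rule computable_naryI) (simp add: *)
qed

lemma computable_nary_Least1:
  assumes "decidable_nary 2 (\<lambda>xs. P (xs ! 0) (xs ! 1))" and "\<And>a. \<exists>k. P k a"
  shows "computable_nary 1 (\<lambda>xs. LEAST k. P k (xs ! 0))"
proof (rule computable_nary_Least)
  show "decidable_nary (Suc 1) (\<lambda>xs. P (hd xs) (tl xs ! 0))"
    using assms(1) unfolding decidable_nary_def
    by (simp add: numeral_2_eq_2, elim computable_nary_cong) (auto simp: length_Suc_conv)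
qed (use assms in auto)

lemma computable_nary_Least2:
  assumes "decidable_nary 3 (\<lambda>xs. P (xs ! 0) (xs ! 1) (xs ! 2))" and "\<And>a b. \<exists>k. P k a b"
  shows "computable_nary 2 (\<lambda>xs. LEAST k. P k (xs ! 0) (xs ! 1))"
proof (rule computable_nary_Least)
  show "decidable_nary (Suc 2) (\<lambda>xs. P (hd xs) (tl xs ! 0) (tl xs ! 1))"
    using assms(1) unfolding decidable_nary_def
    by (simp add: numeral_2_eq_2 numeral_3_eq_3, elim computable_nary_cong) (auto simp: length_Suc_conv)
qed (use assms in auto)

lemma computable_nary_add:
  assumes "computable_nary n f" "computable_nary n g"
  shows "computable_nary n (\<lambda>xs. f xs + g xs)"
proof -
  have "rec_nat b (\<lambda>k r. Suc r) a = a + b" for a b :: nat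
    by (induction a) auto
  moreover have "computable_nary 2 (\<lambda>xs. rec_nat (xs ! 1) (\<lambda>k r. Suc r) (xs ! 0))"
    by (rule computable_nary_rec2[of "\<lambda>a. a" "\<lambda>k r a. Suc r"])
      (intro computable_nary_Suc computable_nary_proj; simp)+
  ultimately show ?thesis
    using computable_nary_comp2[of "(+)"] assms by simp
qed

lemma computable_nary_mult:
  assumes "computable_nary n f" "computable_nary n g"
  shows "computable_nary n (\<lambda>xs. f xs * g xs)"
proof -
  have "rec_nat 0 (\<lambda>k r. r + b) a = a * b" for a b :: nat
    by (induction a) auto
  moreover have "computable_nary 2 (\<lambda>xs. rec_nat 0 (\<lambda>k r. r + xs ! 1) (xs ! 0))"
    by (rule computable_nary_rec2[of "\<lambda>a. 0" "\<lambda>k r a. r + a"])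
      (intro computable_nary_add computable_nary_const computable_nary_proj; simp)+
  ultimately show ?thesis
    using computable_nary_comp2[of "(*)"] assms by simp
qed

lemma computable_nary_power:
  assumes "computable_nary n f" "computable_nary n g"
  shows "computable_nary n (\<lambda>xs. f xs ^ g xs)"
proof -
  have "rec_nat 1 (\<lambda>k r. r * b) a = b ^ a" for a b :: nat
    by (induction a) auto
  moreover have "computable_nary 2 (\<lambda>xs. rec_nat 1 (\<lambda>k r. r * xs ! 1) (xs ! 0))"
    by (rule computable_nary_rec2[of "\<lambda>a. 1" "\<lambda>k r a. r * a"])
      (intro computable_nary_mult computable_nary_const computable_nary_proj; simp)+
  ultimately show ?thesis
    using computable_nary_comp2[of "\<lambda>a b. b ^ a"] assms by simp
qed

lemma computable_nary_diff:
  assumes "computable_nary n f" "computable_nary n g"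
  shows "computable_nary n (\<lambda>xs. f xs - g xs)"
proof -
  have "rec_nat 0 (\<lambda>k r. k) a = a - 1" for a :: nat
    by (cases a) auto
  moreover have "computable_nary 1 (\<lambda>xs. rec_nat 0 (\<lambda>k r. k) (xs ! 0))"
    by (rule computable_nary_rec1) (intro computable_nary_proj; simp)
  ultimately have pred: "computable_nary 1 (\<lambda>xs. xs ! 0 - 1)" by simp
  have "rec_nat b (\<lambda>k r. r - 1) a = b - a" for a b :: nat
    by (induction a) auto
  moreover have "computable_nary 2 (\<lambda>xs. rec_nat (xs ! 1) (\<lambda>k r. r - 1) (xs ! 0))"
    by (rule computable_nary_rec2[of "\<lambda>a. a" "\<lambda>k r a. r - 1"])
      (intro computable_nary_comp1[OF pred] computable_nary_proj; simp)+
  ultimately show ?thesis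
    using computable_nary_comp2[of "\<lambda>a b. b - a"] assms by simp
qed

lemmas computable_nary_intros = computable_nary_const computable_nary_proj computable_nary_Suc
  computable_nary_add computable_nary_mult computable_nary_power computable_nary_diff

lemma decidable_nary_le:
  assumes "computable_nary n f" "computable_nary n g"
  shows "decidable_nary n (\<lambda>xs. f xs \<le> g xs)"
proof -
  have "computable_nary n (\<lambda>xs. 1 - (1 - (f xs - g xs)))"
    by (intro computable_nary_intros assms)
  then show ?thesis
    unfolding decidable_nary_def by (rule computable_nary_cong) auto
qed

lemma decidable_nary_not: "decidable_nary n P \<Longrightarrow> decidable_nary n (\<lambda>xs. \<not> P xs)"
  unfolding decidable_nary_def
  by (rule computable_nary_cong[OF computable_nary_diff[OF computable_nary_const[of n 1]]]) auto

lemma decidable_nary_disj: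
  assumes "decidable_nary n P" "decidable_nary n Q"
  shows "decidable_nary n (\<lambda>xs. P xs \<or> Q xs)"
  using computable_nary_mult[OF assms[unfolded decidable_nary_def]]
  unfolding decidable_nary_def by (rule computable_nary_cong) auto

lemma decidable_nary_conj:
  assumes "decidable_nary n P" "decidable_nary n Q"
  shows "decidable_nary n (\<lambda>xs. P xs \<and> Q xs)"
  using decidable_nary_not[OF decidable_nary_disj[OF assms[THEN decidable_nary_not]]] by simp

lemma decidable_nary_less:
  assumes "computable_nary n f" "computable_nary n g"
  shows "decidable_nary n (\<lambda>xs. f xs < g xs)"
  using decidable_nary_not[OF decidable_nary_le[OF assms(2,1)]] by (simp add: not_le)

text \<open>
  Division by two is a search for the quotient; it lists every term of a name twice.
\<close>

lemma computable_nary_half: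
  assumes "computable_nary n f"
  shows "computable_nary n (\<lambda>xs. f xs div 2)"
proof -
  have "(LEAST k. a < 2 * Suc k) = a div 2" for a :: nat
    by (rule Least_equality) auto
  moreover have "computable_nary 1 (\<lambda>xs. LEAST k. xs ! 0 < 2 * Suc k)"
  proof (rule computable_nary_Least1)
    show "decidable_nary 2 (\<lambda>xs. xs ! 1 < 2 * Suc (xs ! 0))"
      by (intro decidable_nary_less computable_nary_intros; simp)
    show "\<exists>k. a < 2 * Suc k" for a
      by (rule exI[of _ a]) simp
  qed
  ultimately show ?thesis
    using computable_nary_comp1[of "\<lambda>a. a div 2"] assms by simp
qed


section \<open>Computable functions with rational values\<close>

text \<open>
  Cantor's pairing function, in a form whose inverse needs a single unbounded search: the sum of
  the two components is the index of the largest triangle number that is not above the code.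
\<close>

definition triangle_number :: "nat \<Rightarrow> nat" where
  "triangle_number = rec_nat 0 (\<lambda>k r. r + Suc k)"

definition pair_code :: "nat \<Rightarrow> nat \<Rightarrow> nat" where
  "pair_code a b = triangle_number (a + b) + a"

definition code_sum :: "nat \<Rightarrow> nat" where
  "code_sum z = (LEAST s. z < triangle_number (Suc s))"

definition code_fst :: "nat \<Rightarrow> nat" where
  "code_fst z = z - triangle_number (code_sum z)"

definition code_snd :: "nat \<Rightarrow> nat" where
  "code_snd z = code_sum z - code_fst z"

lemma triangle_number_Suc: "triangle_number (Suc n) = triangle_number n + Suc n"
  by (simp add: triangle_number_def)

lemma triangle_number_mono: "m \<le> n \<Longrightarrow> triangle_number m \<le> triangle_number n"
  by (rule lift_Suc_mono_le) (simp_all add: triangle_number_Suc)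

lemma code_sum_pair_code: "code_sum (pair_code a b) = a + b"
  unfolding code_sum_def pair_code_def
proof (rule Least_equality)
  show "triangle_number (a + b) + a < triangle_number (Suc (a + b))"
    by (simp add: triangle_number_Suc)
next
  fix s assume "triangle_number (a + b) + a < triangle_number (Suc s)"
  then show "a + b \<le> s"
    using triangle_number_mono[of "Suc s" "a + b"] by (cases "a + b \<le> s") auto
qed

lemma code_fst_pair_code: "code_fst (pair_code a b) = a"
  unfolding code_fst_def code_sum_pair_code by (simp add: pair_code_def)

lemma code_snd_pair_code: "code_snd (pair_code a b) = b"
  unfolding code_snd_def code_sum_pair_code code_fst_pair_code by simp

lemma computable_nary_triangle_number:
  "computable_nary n f \<Longrightarrow> computable_nary n (\<lambda>xs. triangle_number (f xs))"
  unfolding triangle_number_def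
  by (rule computable_nary_comp1[OF computable_nary_rec1]) (intro computable_nary_intros; simp)+

lemma computable_nary_pair_code:
  "computable_nary n f \<Longrightarrow> computable_nary n g \<Longrightarrow> computable_nary n (\<lambda>xs. pair_code (f xs) (g xs))"
  unfolding pair_code_def by (intro computable_nary_intros computable_nary_triangle_number)

lemma computable_nary_code_sum:
  "computable_nary n f \<Longrightarrow> computable_nary n (\<lambda>xs. code_sum (f xs))"
  unfolding code_sum_def
proof (rule computable_nary_comp1[OF computable_nary_Least1])
  show "decidable_nary 2 (\<lambda>xs. xs ! 1 < triangle_number (Suc (xs ! 0)))"
    by (intro decidable_nary_less computable_nary_intros computable_nary_triangle_number; simp)
  show "\<exists>k. z < triangle_number (Suc k)" for z
    by (rule exI[of _ z]) (simp add: triangle_number_Suc)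
qed

lemma computable_nary_code_fst:
  "computable_nary n f \<Longrightarrow> computable_nary n (\<lambda>xs. code_fst (f xs))"
  unfolding code_fst_def
  by (intro computable_nary_diff computable_nary_triangle_number computable_nary_code_sum)

lemma computable_nary_code_snd:
  "computable_nary n f \<Longrightarrow> computable_nary n (\<lambda>xs. code_snd (f xs))"
  unfolding code_snd_def
  by (intro computable_nary_diff computable_nary_code_fst computable_nary_code_sum)

text \<open>
  Codes for nonnegative rationals suffice: approximations from below of a positive number can be
  cut off at zero.
\<close>

definition decode_rational :: "nat \<Rightarrow> real" where
  "decode_rational z = real (code_fst z) / real (Suc (code_snd z))"

text \<open>
  Only the values are rational. A rational argument is expressed by applying \<open>decode_rational\<close> to a natural number argument.
\<close>

definition rational_nary :: "nat \<Rightarrow> (nat list \<Rightarrow> real) \<Rightarrow> bool" where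
  "rational_nary n f \<longleftrightarrow> (\<exists>a b. computable_nary n a \<and> computable_nary n b \<and>
     (\<forall>xs. length xs = n \<longrightarrow> f xs = real (a xs) / real (Suc (b xs))))"

lemma rational_naryI:
  assumes "computable_nary n a" "computable_nary n b"
    "\<And>xs. length xs = n \<Longrightarrow> b xs > 0 \<and> f xs = real (a xs) / real (b xs)"
  shows "rational_nary n f"
proof -
  have "computable_nary n (\<lambda>xs. b xs - 1)"
    by (intro computable_nary_intros assms)
  then show ?thesis
    unfolding rational_nary_def using assms
    by (intro exI[of _ a] exI[of _ "\<lambda>xs. b xs - 1"]) auto
qed

lemma rational_naryE:
  assumes "rational_nary n f"
  obtains a b where "computable_nary n a" "computable_nary n b"
    "\<And>xs. length xs = n \<Longrightarrow> b xs > 0 \<and> f xs = real (a xs) / real (b xs)"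
proof -
  obtain a b where *: "computable_nary n a" "computable_nary n b"
     "\<forall>xs. length xs = n \<longrightarrow> f xs = real (a xs) / real (Suc (b xs))"
    using assms unfolding rational_nary_def by blast
  show ?thesis
    by (rule that[OF *(1) computable_nary_Suc[OF *(2)]]) (use *(3) in auto)
qed

lemma rational_nary_decode:
  assumes "computable_nary n f"
  shows "rational_nary n (\<lambda>xs. decode_rational (f xs))"
  unfolding decode_rational_def rational_nary_def
  using computable_nary_code_fst[OF assms] computable_nary_code_snd[OF assms] by blast

lemma rational_nary_comp1:
  assumes "rational_nary 1 (\<lambda>xs. \<phi> (xs ! 0))" and "computable_nary n f"
  shows "rational_nary n (\<lambda>xs. \<phi> (f xs))"
proof -
  obtain a b where ab: "computable_nary 1 a" "computable_nary 1 b"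
      "\<And>xs. length xs = 1 \<Longrightarrow> b xs > 0 \<and> \<phi> (xs ! 0) = real (a xs) / real (b xs)"
    using assms(1) by (rule rational_naryE) blast
  have "computable_nary n (\<lambda>xs. a [f xs])" "computable_nary n (\<lambda>xs. b [f xs])"
    using computable_nary_comp[of "[f]" _ n] ab assms(2) by auto
  then show ?thesis
    by (rule rational_naryI) (use ab(3)[of "[f xs]" for xs] in auto)
qed

lemma rational_nary_half_power:
  assumes "computable_nary n f"
  shows "rational_nary n (\<lambda>xs. 1 / 2 ^ f xs)"
  by (rule rational_naryI[of _ "\<lambda>xs. 1" "\<lambda>xs. 2 ^ f xs"]) (auto intro: computable_nary_intros assms)

lemma rational_nary_add:
  assumes "rational_nary n f" "rational_nary n g"
  shows "rational_nary n (\<lambda>xs. f xs + g xs)"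
proof -
  obtain a b where ab: "computable_nary n a" "computable_nary n b"
      "\<And>xs. length xs = n \<Longrightarrow> b xs > 0 \<and> f xs = real (a xs) / real (b xs)"
    using assms(1) by (rule rational_naryE) blast
  obtain c d where cd: "computable_nary n c" "computable_nary n d"
      "\<And>xs. length xs = n \<Longrightarrow> d xs > 0 \<and> g xs = real (c xs) / real (d xs)"
    using assms(2) by (rule rational_naryE) blast
  show ?thesis
  proof (rule rational_naryI)
    show "computable_nary n (\<lambda>xs. a xs * d xs + c xs * b xs)" "computable_nary n (\<lambda>xs. b xs * d xs)"
      by (intro computable_nary_intros ab cd)+
  qed (use ab(3) cd(3) in \<open>auto simp: add_frac_eq\<close>)
qed

lemma rational_nary_mult:
  assumes "rational_nary n f" "rational_nary n g"
  shows "rational_nary n (\<lambda>xs. f xs * g xs)"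
proof -
  obtain a b where ab: "computable_nary n a" "computable_nary n b"
      "\<And>xs. length xs = n \<Longrightarrow> b xs > 0 \<and> f xs = real (a xs) / real (b xs)"
    using assms(1) by (rule rational_naryE) blast
  obtain c d where cd: "computable_nary n c" "computable_nary n d"
      "\<And>xs. length xs = n \<Longrightarrow> d xs > 0 \<and> g xs = real (c xs) / real (d xs)"
    using assms(2) by (rule rational_naryE) blast
  show ?thesis
  proof (rule rational_naryI)
    show "computable_nary n (\<lambda>xs. a xs * c xs)" "computable_nary n (\<lambda>xs. b xs * d xs)"
      by (intro computable_nary_intros ab cd)+
  qed (use ab(3) cd(3) in auto)
qed

lemma rational_nary_zero: "rational_nary n (\<lambda>xs. 0)"
  by (rule rational_naryI[of _ "\<lambda>xs. 0" "\<lambda>xs. 1"]) (auto intro: computable_nary_const)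

lemma rational_nary_divide_2_power: "rational_nary n f \<Longrightarrow> rational_nary n (\<lambda>xs. f xs / 2 ^ e)"
  using rational_nary_mult[OF _ rational_nary_half_power[OF computable_nary_const[of n e]]] by simp

lemma decidable_nary_rational_le:
  assumes "rational_nary n f" "rational_nary n g"
  shows "decidable_nary n (\<lambda>xs. f xs \<le> g xs)"
proof -
  obtain a b where ab: "computable_nary n a" "computable_nary n b"
      "\<And>xs. length xs = n \<Longrightarrow> b xs > 0 \<and> f xs = real (a xs) / real (b xs)"
    using assms(1) by (rule rational_naryE) blast
  obtain c d where cd: "computable_nary n c" "computable_nary n d"
      "\<And>xs. length xs = n \<Longrightarrow> d xs > 0 \<and> g xs = real (c xs) / real (d xs)"
    using assms(2) by (rule rational_naryE) blast
  have "f xs \<le> g xs \<longleftrightarrow> a xs * d xs \<le> c xs * b xs" if "length xs = n" for xs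
  proof -
    have "f xs \<le> g xs \<longleftrightarrow> real (a xs) * real (d xs) \<le> real (c xs) * real (b xs)"
      using ab(3)[OF that] cd(3)[OF that] by (simp add: field_simps)
    then show ?thesis by (simp flip: of_nat_mult)
  qed
  moreover have "decidable_nary n (\<lambda>xs. a xs * d xs \<le> c xs * b xs)"
    by (intro decidable_nary_le computable_nary_intros ab cd)
  ultimately show ?thesis
    unfolding decidable_nary_def by (elim computable_nary_cong) auto
qed

lemma decidable_nary_rational_less:
  assumes "rational_nary n f" "rational_nary n g"
  shows "decidable_nary n (\<lambda>xs. f xs < g xs)"
  using decidable_nary_not[OF decidable_nary_rational_le[OF assms(2,1)]] by (simp add: not_le)

lemmas rational_nary_intros = rational_nary_zero rational_nary_half_power rational_nary_add
  rational_nary_decode rational_nary_divide_2_power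
lemmas decidable_nary_intros = decidable_nary_conj decidable_nary_disj
  decidable_nary_rational_le decidable_nary_rational_less

text \<open>
  One natural number suffices as the value of a rational-valued function, so it can be passed on
  as an argument, in particular as the state of a recursion.
\<close>

lemma rational_nary_code:
  assumes "rational_nary n f"
  obtains c where "computable_nary n c" "\<And>xs. length xs = n \<Longrightarrow> f xs = decode_rational (c xs)"
proof -
  obtain a b where ab: "computable_nary n a" "computable_nary n b"
     "\<forall>xs. length xs = n \<longrightarrow> f xs = real (a xs) / real (Suc (b xs))"
    using assms unfolding rational_nary_def by blast
  show ?thesis
    by (rule that[OF computable_nary_pair_code[OF ab(1,2)]])
      (use ab(3) in \<open>simp add: decode_rational_def code_fst_pair_code code_snd_pair_code\<close>)
qed

text \<open>
  Recursion with a rational state is recursion on codes. The step \<open>h\<close> is a function of the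
  rational and not of its code, so the choice of the code does not influence the result.
\<close>

lemma rational_nary_rec:
  assumes "rational_nary 2 (\<lambda>xs. h (xs ! 0) (decode_rational (xs ! 1)))"
  shows "rational_nary 1 (\<lambda>xs. rec_nat 0 h (xs ! 0))"
proof -
  obtain c where c: "computable_nary 2 c"
      "\<And>xs. length xs = 2 \<Longrightarrow> h (xs ! 0) (decode_rational (xs ! 1)) = decode_rational (c xs)"
    using assms by (rule rational_nary_code) blast
  define H where "H = (\<lambda>t z. c [t, z])"
  have "computable_nary 2 (\<lambda>xs. H (xs ! 0) (xs ! 1))"
    by (rule computable_nary_cong[OF c(1)]) (auto simp: H_def length_Suc_conv numeral_2_eq_2)
  then have "computable_nary 1 (\<lambda>xs. rec_nat (pair_code 0 0) H (xs ! 0))"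
    by (rule computable_nary_rec1)
  then have "rational_nary 1 (\<lambda>xs. decode_rational (rec_nat (pair_code 0 0) H (xs ! 0)))"
    by (rule rational_nary_decode)
  moreover have "decode_rational (H t z) = h t (decode_rational z)" for t z
    using c(2)[of "[t, z]"] by (simp add: H_def)
  then have "decode_rational (rec_nat (pair_code 0 0) H t) = rec_nat 0 h t" for t
    by (induction t) (simp_all add: decode_rational_def code_fst_pair_code)
  ultimately show ?thesis by simp
qed



section \<open>Tails of names\<close>

text \<open>
  The computable rate of convergence of the reordered series, expressed by finite partial sums
  of the name in its original order: the terms from level \<open>s n\<close> on contribute at most \<open>2^-n\<close>.
\<close>

definition tail_modulus :: "(nat \<Rightarrow> nat) \<Rightarrow> (nat \<Rightarrow> nat) \<Rightarrow> bool" where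
  "tail_modulus f s \<longleftrightarrow> (\<forall>n m. (\<Sum>i<m. if s n \<le> f i then 1 / 2 ^ f i else 0) \<le> (1 / 2 ^ n :: real))"

lemma name_sum_le:
  assumes "is_name f x" "finite S"
  shows "(\<Sum>i\<in>S. 1 / 2 ^ f i) \<le> x"
proof -
  have sums: "(\<lambda>k. 1 / 2 ^ f k) sums x"
    using assms(1) by (simp only: is_name_def)
  have "(\<Sum>i\<in>S. 1 / 2 ^ f i) \<le> (\<Sum>k. 1 / 2 ^ f k :: real)"
    by (rule sum_le_suminf[OF sums_summable[OF sums] assms(2)]) simp
  then show ?thesis by (simp only: sums_unique[OF sums])
qed

lemma name_finite_below:
  assumes "is_name f x"
  shows "finite {i. f i < K}"
proof -
  have "(\<lambda>i. 1 / 2 ^ f i :: real) \<longlonglongrightarrow> 0"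
    using assms unfolding is_name_def by (rule summable_LIMSEQ_zero[OF sums_summable])
  then have "eventually (\<lambda>i. (1 / 2 ^ f i :: real) < 1 / 2 ^ K) sequentially"
    by (rule order_tendstoD(2)) simp
  then obtain N where N: "\<And>i. i \<ge> N \<Longrightarrow> (1 / 2 ^ f i :: real) < 1 / 2 ^ K"
    unfolding eventually_sequentially by blast
  have "i < N" if "f i < K" for i
  proof (rule ccontr)
    assume "\<not> i < N"
    then have "(2::real) ^ K < 2 ^ f i" using N[of i] by (simp add: field_simps)
    then show False using that by simp
  qed
  then show ?thesis by (intro finite_subset[OF _ finite_lessThan[of N]]) auto
qed

lemma multiplicity_partial_sum:
  assumes "is_name f x"
  shows "(\<Sum>k<K. real (multiplicity_fn f k) * (1 / 2 ^ k)) = (\<Sum>i | f i < K. 1 / 2 ^ f i)"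
proof -
  have "(\<Sum>k<K. real (multiplicity_fn f k) * (1 / 2 ^ k))
      = (\<Sum>k<K. \<Sum>i\<in>{i \<in> {i. f i < K}. f i = k}. 1 / 2 ^ f i)"
  proof (rule sum.cong[OF refl])
    fix k assume "k \<in> {..<K}"
    then have "{i \<in> {i. f i < K}. f i = k} = {i. f i = k}" by auto
    then show "real (multiplicity_fn f k) * (1 / 2 ^ k)
        = (\<Sum>i\<in>{i \<in> {i. f i < K}. f i = k}. 1 / 2 ^ f i)"
      by (simp add: multiplicity_fn_def)
  qed
  also have "\<dots> = (\<Sum>i | f i < K. 1 / 2 ^ f i)"
    by (rule sum.group) (use name_finite_below[OF assms] in auto)
  finally show ?thesis .
qed

text \<open>
  Finitely many terms of level at least \<open>s n\<close> can be added to the partial sum up to \<open>s n\<close> and still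
  lie in a later partial sum, hence below the limit.
\<close>

lemma tail_modulus_if_converges:
  assumes f: "is_name f x"
    and "series_converges_computably (\<lambda>k. real (multiplicity_fn f k) * (1 / 2 ^ k))"
  obtains s where "computable s" "tail_modulus f s"
proof -
  define P where "P K = (\<Sum>i | f i < K. 1 / 2 ^ f i :: real)" for K
  obtain L s where L: "P \<longlonglongrightarrow> L" and s: "computable s" "\<And>n k. k \<ge> s n \<Longrightarrow> \<bar>L - P k\<bar> \<le> 1 / 2 ^ n"
    using assms(2) unfolding series_converges_computably_def converges_computably_def
      multiplicity_partial_sum[OF f] P_def by auto
  have fin: "finite {i. f i < K}" for K
    by (rule name_finite_below[OF f])
  have "incseq P"
    unfolding P_def by (intro incseq_SucI sum_mono2 fin) auto
  then have P_le: "P K \<le> L" for K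
    using L by (rule incseq_le)
  have "tail_modulus f s"
    unfolding tail_modulus_def
  proof (intro allI)
    fix n m
    have "finite (f ` {..<m})" by simp
    then obtain K where K: "\<And>i. i < m \<Longrightarrow> f i < K"
      unfolding finite_nat_set_iff_bounded by auto
    let ?S = "{i \<in> {..<m}. s n \<le> f i}"
    have "P (s n) + (\<Sum>i\<in>?S. 1 / 2 ^ f i) = (\<Sum>i\<in>{i. f i < s n} \<union> ?S. 1 / 2 ^ f i)"
      unfolding P_def by (intro sum.union_disjoint[symmetric] fin) auto
    also have "\<dots> \<le> P (max K (s n))"
      unfolding P_def using K by (intro sum_mono2 fin) (auto simp: less_max_iff_disj)
    also have "\<dots> \<le> L" by (rule P_le)
    finally have "(\<Sum>i\<in>?S. 1 / 2 ^ f i) \<le> (1 / 2 ^ n :: real)"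
      using s(2)[of n "s n"] by linarith
    moreover have "(\<Sum>i\<in>?S. 1 / 2 ^ f i) = (\<Sum>i<m. if s n \<le> f i then 1 / 2 ^ f i else (0::real))"
      by (rule sum.inter_filter) simp
    ultimately show "(\<Sum>i<m. if s n \<le> f i then 1 / 2 ^ f i else 0) \<le> (1 / 2 ^ n :: real)" by simp
  qed
  then show ?thesis using that s(1) by blast
qed

lemma reordered_computable_if_tail_modulus:
  assumes "computable f" "is_name f x" "computable s" "tail_modulus f s"
  shows "reordered_computable x"
proof -
  define P where "P K = (\<Sum>i | f i < K. 1 / 2 ^ f i :: real)" for K
  have fin: "finite {i. f i < K}" for K
    by (rule name_finite_below[OF assms(2)])
  have close: "\<bar>x - P K\<bar> \<le> 1 / 2 ^ n" if "s n \<le> K" for n K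
  proof -
    have "P K \<le> x"
      unfolding P_def by (rule name_sum_le[OF assms(2) fin])
    moreover have "(\<Sum>i<m. 1 / 2 ^ f i) \<le> P K + 1 / 2 ^ n" for m
    proof -
      have "(\<Sum>i<m. 1 / 2 ^ f i :: real)
          \<le> (\<Sum>i<m. (if f i < K then 1 / 2 ^ f i else 0) + (if s n \<le> f i then 1 / 2 ^ f i else 0))"
        by (rule sum_mono) (use that in auto)
      also have "\<dots> = (\<Sum>i<m. if f i < K then 1 / 2 ^ f i else 0)
          + (\<Sum>i<m. if s n \<le> f i then 1 / 2 ^ f i else 0)"
        by (rule sum.distrib)
      also have "(\<Sum>i<m. if f i < K then 1 / 2 ^ f i else 0) = (\<Sum>i\<in>{i \<in> {..<m}. f i < K}. 1 / 2 ^ f i :: real)"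
        by (rule sum.inter_filter[symmetric]) simp
      also have "\<dots> \<le> P K"
        unfolding P_def by (intro sum_mono2 fin) auto
      also have "(\<Sum>i<m. if s n \<le> f i then 1 / 2 ^ f i else 0) \<le> (1 / 2 ^ n :: real)"
        using assms(4) unfolding tail_modulus_def by blast
      finally show ?thesis by simp
    qed
    then have "x \<le> P K + 1 / 2 ^ n"
      using LIMSEQ_le_const2[OF assms(2)[unfolded is_name_def sums_def]] by blast
    ultimately show ?thesis by auto
  qed
  have "P \<longlonglongrightarrow> x"
  proof (rule LIMSEQ_I)
    fix e :: real assume "e > 0"
    then obtain n where n: "(1/2) ^ n < e"
      using real_arch_pow_inv[of e "1/2"] by auto
    have "norm (P K - x) < e" if "K \<ge> s n" for K
      using close[OF that] n by (simp add: power_one_over abs_minus_commute)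
    then show "\<exists>K0. \<forall>K\<ge>K0. norm (P K - x) < e" by blast
  qed
  then have "series_converges_computably (\<lambda>k. real (multiplicity_fn f k) * (1 / 2 ^ k))"
    unfolding series_converges_computably_def converges_computably_def
      multiplicity_partial_sum[OF assms(2)] P_def[symmetric]
    using assms(3) close by blast
  then show ?thesis
    unfolding reordered_computable_def using assms by blast
qed

text \<open>
  In the name that lists every term twice, each tail is twice as large, which a shift of the
  modulus by one compensates.
\<close>

lemma reordered_computable_double:
  assumes "reordered_computable x"
  shows "reordered_computable (2 * x)"
proof -
  obtain f where f: "computable f" "is_name f x"
      "series_converges_computably (\<lambda>k. real (multiplicity_fn f k) * (1 / 2 ^ k))"
    using assms unfolding reordered_computable_def by blast
  obtain s where s: "computable s" "tail_modulus f s"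
    using tail_modulus_if_converges[OF f(2,3)] by blast
  let ?f = "\<lambda>i. f (i div 2)"
  have "computable ?f"
    unfolding computable_iff_nary
    by (intro computable_nary_computable[OF f(1)] computable_nary_half computable_nary_proj) simp
  moreover have "is_name ?f (2 * x)"
  proof -
    have "(\<lambda>i. if even i then 1 / 2 ^ f (i div 2) else 1 / 2 ^ f ((i - 1) div 2)) sums (x + x)"
      using f(2) unfolding is_name_def by (intro sums_if)
    moreover have "(if even i then 1 / 2 ^ f (i div 2) else 1 / 2 ^ f ((i - 1) div 2))
        = (1 / 2 ^ f (i div 2) :: real)" for i
      by (auto elim!: oddE)
    ultimately show ?thesis
      unfolding is_name_def by simp
  qed
  moreover have "computable (\<lambda>n. s (Suc n))"
    unfolding computable_iff_nary
    by (intro computable_nary_computable[OF s(1)] computable_nary_intros) simp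
  moreover have "tail_modulus ?f (\<lambda>n. s (Suc n))"
    unfolding tail_modulus_def
  proof (intro allI)
    fix n m
    define h where "h i = (if s (Suc n) \<le> f i then 1 / 2 ^ f i else 0 :: real)" for i
    have "(\<Sum>i<m. h (i div 2)) \<le> (\<Sum>i<2 * m. h (i div 2))"
      by (rule sum_mono2) (auto simp: h_def)
    also have "\<dots> = 2 * (\<Sum>i<m. h i)"
      by (induction m) (simp_all add: distrib_left)
    also have "\<dots> \<le> 2 * (1 / 2 ^ Suc n)"
      using s(2) unfolding tail_modulus_def h_def by (intro mult_left_mono) (blast, simp)
    finally show "(\<Sum>i<m. if s (Suc n) \<le> ?f i then 1 / 2 ^ ?f i else 0) \<le> (1 / 2 ^ n :: real)"
      by (simp add: h_def)
  qed
  ultimately show ?thesis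
    by (rule reordered_computable_if_tail_modulus)
qed

lemma reordered_computable_mult_2_power:
  "reordered_computable (x / 2 ^ e) \<Longrightarrow> reordered_computable x"
proof (induction e)
  case (Suc e)
  then show ?case using reordered_computable_double[of "x / 2 ^ Suc e"] by simp
qed simp


section \<open>The reservoir\<close>

text \<open>
  At time \<open>t\<close> the term \<open>1 / 2 ^ f t\<close> flows in, and then half of the content flows out. Thus
  \<open>reservoir f (Suc t)\<close> is both the amount left and the amount paid out at time \<open>t\<close>.
\<close>

definition reservoir :: "(nat \<Rightarrow> nat) \<Rightarrow> nat \<Rightarrow> real" where
  "reservoir f = rec_nat 0 (\<lambda>t r. (r + 1 / 2 ^ f t) / 2)"

lemma reservoir_0: "reservoir f 0 = 0"
  and reservoir_Suc: "reservoir f (Suc t) = (reservoir f t + 1 / 2 ^ f t) / 2"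
  by (simp_all add: reservoir_def)

lemma reservoir_nonneg: "0 \<le> reservoir f t"
  by (induction t) (simp_all add: reservoir_0 reservoir_Suc)

lemma reservoir_Suc_pos: "0 < reservoir f (Suc t)"
  unfolding reservoir_Suc by (intro divide_pos_pos add_nonneg_pos reservoir_nonneg) auto

lemma reservoir_less_1: "reservoir f t < 1"
proof (induction t)
  case (Suc t)
  have "(1 / 2 ^ f t :: real) \<le> 1" by simp
  then have "reservoir f t + 1 / 2 ^ f t < 2" using Suc by linarith
  then show ?case by (simp add: reservoir_Suc)
qed (simp add: reservoir_0)

lemma reservoir_eq_sum: "reservoir f (Suc t) = (\<Sum>i\<le>t. 1 / 2 ^ f i / 2 ^ Suc (t - i))"
proof (induction t)
  case (Suc t)
  have "(\<Sum>i\<le>Suc t. 1 / 2 ^ f i / 2 ^ Suc (Suc t - i))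
      = (\<Sum>i\<le>t. 1 / 2 ^ f i / 2 ^ Suc (t - i) / 2) + (1 / 2 ^ f (Suc t) / 2 :: real)"
    by (simp add: Suc_diff_le mult_ac)
  also have "\<dots> = reservoir f (Suc (Suc t))"
    by (simp only: reservoir_Suc[of f "Suc t"] Suc.IH sum_divide_distrib add_divide_distrib)
  finally show ?case by simp
qed (simp add: reservoir_0 reservoir_Suc)

text \<open>
  By conservation, the payouts up to time \<open>t\<close> and the content sum up to the inflow, which is at
  most \<open>y\<close>. So the payouts are summable, and they equal the contents.
\<close>

lemma reservoir_tendsto_0:
  assumes "is_name f y"
  shows "reservoir f \<longlonglongrightarrow> 0"
proof -
  have step: "reservoir f (Suc t) = reservoir f t + 1 / 2 ^ f t - reservoir f (Suc t)" for t
    unfolding reservoir_Suc by (rule eq_diff_eq[THEN iffD2]) (rule field_sum_of_halves)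
  have "(\<Sum>i<t. reservoir f (Suc i)) = (\<Sum>i<t. 1 / 2 ^ f i) - reservoir f t" for t
  proof (induction t)
    case (Suc t)
    then show ?case using step[of t] unfolding sum.lessThan_Suc by linarith
  qed (simp add: reservoir_0)
  then have "(\<Sum>i<t. reservoir f (Suc i)) \<le> y" for t
    using name_sum_le[OF assms, of "{..<t}"] reservoir_nonneg[of f t] by simp
  then have "summable (\<lambda>i. reservoir f (Suc i))"
    by (intro summableI_nonneg_bounded reservoir_nonneg)
  then show ?thesis
    by (rule LIMSEQ_imp_Suc[OF summable_LIMSEQ_zero])
qed

lemma min_sum_le:
  fixes a :: "'a \<Rightarrow> real"
  assumes "finite A" "\<And>i. i \<in> A \<Longrightarrow> 0 \<le> a i" "0 \<le> d"
  shows "min d (sum a A) \<le> (\<Sum>i\<in>A. min d (a i))"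
  using assms(1,2)
proof (induction rule: finite_induct)
  case (insert i A)
  have "0 \<le> sum a A" "0 \<le> a i" using insert.prems by (auto intro: sum_nonneg)
  then have "min d (a i + sum a A) \<le> min d (a i) + min d (sum a A)"
    using assms(3) by linarith
  then show ?case using insert by force
qed (use assms in auto)

lemma sum_min_geometric_le:
  assumes "0 \<le> (a::real)"
  shows "(\<Sum>j<m. min d (a / 2 ^ Suc j)) \<le> a"
proof -
  have "(\<Sum>j<m. min d (a / 2 ^ Suc j)) \<le> (\<Sum>j<m. a / 2 ^ Suc j)"
    by (rule sum_mono) simp
  also have "\<dots> = a - a / 2 ^ m"
    by (induction m) (simp_all add: field_simps)
  also have "\<dots> \<le> a" using assms by simp
  finally show ?thesis .
qed

text \<open>
  The first \<open>K\<close> summands are bounded by the truncation, the others by a geometric series that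
  starts at \<open>a / 2 ^ K\<close>.
\<close>

lemma sum_min_geometric_le_truncated:
  assumes "0 \<le> (a::real)" "a \<le> 1"
  shows "(\<Sum>j<m. min (1 / 2 ^ K) (a / 2 ^ Suc j)) \<le> (real K + 1) / 2 ^ K"
proof -
  have "(\<Sum>j<m. min (1 / 2 ^ K) (a / 2 ^ Suc j)) \<le> (\<Sum>j<K + m. min (1 / 2 ^ K) (a / 2 ^ Suc j))"
    by (rule sum_mono2) (use assms in auto)
  also have "\<dots> = (\<Sum>j<K. min (1 / 2 ^ K) (a / 2 ^ Suc j)) + (\<Sum>j<m. min (1 / 2 ^ K) (a / 2 ^ K / 2 ^ Suc j))"
    by (induction m) (simp_all add: power_add)
  also have "\<dots> \<le> (\<Sum>j<K. 1 / 2 ^ K) + a / 2 ^ K"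
    by (intro add_mono sum_mono sum_min_geometric_le) (use assms in auto)
  also have "\<dots> \<le> (real K + 1) / 2 ^ K"
    using assms by (simp add: field_simps)
  finally show ?thesis .
qed

text \<open>
  A term of level at least \<open>K\<close> is at most the reservoir truncated at \<open>1 / 2 ^ K\<close>, and truncation is
  subadditive. Sorting the truncated contributions by the term \<open>i\<close> of \<open>f\<close> that they stem from, those
  of \<open>i\<close> sum up to at most \<open>1 / 2 ^ f i\<close>, and also to at most \<open>(K + 1) / 2 ^ K\<close>. With
  \<open>K = 2 * (n + 3 + s (Suc n) + b)\<close> the second bound is below \<open>1 / 2 ^ (Suc n + b)\<close> times
  \<open>1 / 2 ^ f i\<close> whenever \<open>f i < s (Suc n)\<close>. So the terms with \<open>s (Suc n) \<le> f i\<close> cost at most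
  \<open>1 / 2 ^ Suc n\<close> by the modulus of \<open>f\<close>, and the others at most as much because the whole sum is
  bounded by \<open>2 ^ b\<close>.
\<close>

lemma tail_modulus_if_below_reservoir:
  assumes f: "is_name f y" "tail_modulus f s" and y: "y \<le> 2 ^ b"
    and g: "\<And>t. 1 / 2 ^ g t \<le> reservoir f (Suc t)"
  shows "tail_modulus g (\<lambda>n. 2 * (n + 3 + s (Suc n) + b))"
  unfolding tail_modulus_def
proof (intro allI)
  fix n m
  define M where "M = n + 3 + s (Suc n) + b"
  define d :: real where "d = 1 / 2 ^ (2 * M)"
  define h where "h i j = min d (1 / 2 ^ f i / 2 ^ Suc j)" for i j
  have h_nonneg: "0 \<le> h i j" for i j by (simp add: h_def d_def)
  have "(if 2 * M \<le> g t then 1 / 2 ^ g t else 0) \<le> (\<Sum>i\<le>t. h i (t - i))" for t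
  proof (cases "2 * M \<le> g t")
    case True
    then have "1 / 2 ^ g t \<le> d"
      unfolding d_def by (intro divide_left_mono power_increasing) auto
    then have "1 / 2 ^ g t \<le> min d (\<Sum>i\<le>t. 1 / 2 ^ f i / 2 ^ Suc (t - i))"
      using g[of t] unfolding reservoir_eq_sum by simp
    also have "\<dots> \<le> (\<Sum>i\<le>t. h i (t - i))"
      unfolding h_def by (rule min_sum_le) (simp_all add: d_def)
    finally show ?thesis using True by simp
  qed (simp add: sum_nonneg h_nonneg)
  then have "(\<Sum>t<m. if 2 * M \<le> g t then 1 / 2 ^ g t else 0) \<le> (\<Sum>t<m. \<Sum>i\<le>t. h i (t - i))"
    by (rule sum_mono)
  also have "\<dots> = (\<Sum>(i, j)\<in>{(i, j). i + j < m}. h i j)"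
    by (rule sum.triangle_reindex[symmetric])
  also have "\<dots> \<le> (\<Sum>(i, j)\<in>{..<m} \<times> {..<m}. h i j)"
    by (rule sum_mono2) (auto simp: h_nonneg)
  also have "\<dots> = (\<Sum>i<m. \<Sum>j<m. h i j)"
    by (rule sum.cartesian_product[symmetric])
  also have "\<dots> \<le> (\<Sum>i<m. (if s (Suc n) \<le> f i then 1 / 2 ^ f i else 0) + 1 / 2 ^ (Suc n + b) * (1 / 2 ^ f i))"
  proof (rule sum_mono)
    fix i
    show "(\<Sum>j<m. h i j) \<le> (if s (Suc n) \<le> f i then 1 / 2 ^ f i else 0) + 1 / 2 ^ (Suc n + b) * (1 / 2 ^ f i)"
    proof (cases "s (Suc n) \<le> f i")
      case True
      have "(\<Sum>j<m. h i j) \<le> 1 / 2 ^ f i"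
        unfolding h_def by (rule sum_min_geometric_le) simp
      also have "\<dots> \<le> 1 / 2 ^ f i + 1 / 2 ^ (Suc n + b) * (1 / 2 ^ f i)" by simp
      finally show ?thesis using True by simp
    next
      case False
      have "2 * M + 1 \<le> 2 ^ M"
      proof -
        have "3 \<le> M" by (simp add: M_def)
        then show ?thesis by (induction M rule: dec_induct) auto
      qed
      then have "real (2 * M) + 1 \<le> 2 ^ M"
        using of_nat_mono[of "2 * M + 1" "2 ^ M", where 'a = real] by simp
      have "(\<Sum>j<m. h i j) \<le> (real (2 * M) + 1) / 2 ^ (2 * M)"
        unfolding h_def d_def by (rule sum_min_geometric_le_truncated) simp_all
      also have "\<dots> \<le> 2 ^ M / 2 ^ (2 * M)"
        by (rule divide_right_mono) (fact, simp)
      also have "\<dots> = 1 / 2 ^ M"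
        by (simp add: mult_2 power_add)
      also have "\<dots> \<le> 1 / 2 ^ (Suc n + b + f i)"
        by (intro divide_left_mono power_increasing) (use False in \<open>auto simp: M_def\<close>)
      finally show ?thesis using False by (simp add: power_add)
    qed
  qed
  also have "\<dots> = (\<Sum>i<m. if s (Suc n) \<le> f i then 1 / 2 ^ f i else 0)
      + 1 / 2 ^ (Suc n + b) * (\<Sum>i<m. 1 / 2 ^ f i)"
    by (simp only: sum.distrib sum_distrib_left)
  also have "\<dots> \<le> 1 / 2 ^ Suc n + 1 / 2 ^ (Suc n + b) * 2 ^ b"
  proof (intro add_mono mult_left_mono)
    show "(\<Sum>i<m. if s (Suc n) \<le> f i then 1 / 2 ^ f i else 0) \<le> (1 / 2 ^ Suc n :: real)"
      using f(2) unfolding tail_modulus_def by blast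
    show "(\<Sum>i<m. 1 / 2 ^ f i) \<le> (2 ^ b :: real)"
      using name_sum_le[OF f(1) finite_lessThan] y by (rule order_trans)
  qed simp
  also have "\<dots> = 1 / 2 ^ n"
    by (simp add: power_add)
  finally show "(\<Sum>t<m. if 2 * (n + 3 + s (Suc n) + b) \<le> g t then 1 / 2 ^ g t else 0) \<le> (1 / 2 ^ n :: real)"
    by (simp only: M_def)
qed


section \<open>The greedy name\<close>

text \<open>
  The construction of the name of \<open>x\<close>. Below, \<open>p (N t)\<close> is a lower bound of \<open>x\<close> whose distance
  to \<open>x\<close> is at most half of what \<open>y\<close> still receives after time \<open>t\<close>, \<open>G t\<close> is the sum of the first
  \<open>t\<close> terms, and \<open>\<kappa> t r\<close> is the next exponent if the sum so far is \<open>r\<close>.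
\<close>

lemma greedy_name:
  assumes p: "rational_nary 1 (\<lambda>xs. p (xs ! 0))" "mono p" "p \<longlonglongrightarrow> x" "\<And>n. p n < x"
    and q: "rational_nary 1 (\<lambda>xs. q (xs ! 0))" "q \<longlonglongrightarrow> y"
    and close: "\<And>n. x - p n \<le> (y - q n) / 2"
    and f: "computable f" "is_name f y"
    and x: "0 < x" "x \<le> y / 2"
  obtains g where "computable g" "is_name g x" "\<And>t. 1 / 2 ^ g t \<le> reservoir f (Suc t)"
proof -
  define Y where "Y t = (\<Sum>i<t. 1 / 2 ^ f i :: real)" for t
  define N where "N t = (LEAST n. Y (Suc t) \<le> q n \<and> 0 < p n)" for t
  \<comment> \<open>The second disjunct makes the search succeed for every rational \<open>r\<close>, as minimization requires;
    \<open>r = G t\<close> never satisfies it.\<close>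
  define \<kappa> where "\<kappa> t r = (LEAST k. (1 / 2 ^ k \<le> reservoir f (Suc t) \<and> r + 1 / 2 ^ k < p (N t)) \<or> p (N t) \<le> r)"
    for t and r :: real
  define G where "G = rec_nat 0 (\<lambda>t r. r + 1 / 2 ^ \<kappa> t r)"
  define g where "g t = \<kappa> t (G t)" for t

  have "Y t < y" for t
  proof -
    have "Y t < Y (Suc t)" by (simp add: Y_def)
    also have "\<dots> \<le> y"
      unfolding Y_def by (rule name_sum_le[OF f(2)]) simp
    finally show ?thesis .
  qed
  have ex_N: "\<exists>n. Y (Suc t) \<le> q n \<and> 0 < p n" for t
  proof -
    have "eventually (\<lambda>n. Y (Suc t) < q n) sequentially"
      by (rule order_tendstoD[OF q(2)]) fact
    moreover have "eventually (\<lambda>n. 0 < p n) sequentially"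
      by (rule order_tendstoD[OF p(3)]) fact
    ultimately have "eventually (\<lambda>n. Y (Suc t) \<le> q n \<and> 0 < p n) sequentially"
      by eventually_elim simp
    then show ?thesis by (rule eventually_happens'[OF sequentially_bot])
  qed
  have ex_\<kappa>: "\<exists>k. (1 / 2 ^ k \<le> reservoir f (Suc t) \<and> r + 1 / 2 ^ k < p (N t)) \<or> p (N t) \<le> r" for t r
  proof (cases "p (N t) \<le> r")
    case False
    then obtain k where "(1/2) ^ k < min (reservoir f (Suc t)) (p (N t) - r)"
      using real_arch_pow_inv[of "min (reservoir f (Suc t)) (p (N t) - r)" "1/2"]
        reservoir_Suc_pos[of f t] by auto
    then show ?thesis by (intro exI[of _ k]) (simp add: power_one_over)
  qed simp

  have rational_f: "rational_nary n (\<lambda>xs. 1 / 2 ^ f (c xs))" if "computable_nary n c" for n c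
    by (intro rational_nary_half_power computable_nary_computable[OF f(1)] that)
  have "Y = rec_nat 0 (\<lambda>i r. r + 1 / 2 ^ f i)"
  proof
    fix t show "Y t = rec_nat 0 (\<lambda>i r. r + 1 / 2 ^ f i) t"
      by (induction t) (simp_all add: Y_def)
  qed
  moreover have "rational_nary 1 (\<lambda>xs. rec_nat 0 (\<lambda>i r. r + 1 / 2 ^ f i) (xs ! 0))"
    by (rule rational_nary_rec) (intro rational_nary_intros rational_f computable_nary_intros; simp)
  ultimately have rational_Y: "rational_nary 1 (\<lambda>xs. Y (xs ! 0))" by simp
  have "rational_nary 1 (\<lambda>xs. rec_nat 0 (\<lambda>t r. (r + 1 / 2 ^ f t) / 2 ^ 1) (xs ! 0))"
    by (rule rational_nary_rec) (intro rational_nary_intros rational_f computable_nary_intros; simp)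
  then have rational_reservoir: "rational_nary 1 (\<lambda>xs. reservoir f (xs ! 0))"
    by (simp add: reservoir_def)
  have computable_N: "computable_nary 1 (\<lambda>xs. N (xs ! 0))"
    unfolding N_def
    by (rule computable_nary_Least1[OF _ ex_N])
      (intro decidable_nary_intros rational_nary_zero rational_nary_comp1[OF rational_Y]
        rational_nary_comp1[OF p(1)] rational_nary_comp1[OF q(1)] computable_nary_intros; simp)
  have computable_\<kappa>: "computable_nary 2 (\<lambda>xs. \<kappa> (xs ! 0) (decode_rational (xs ! 1)))"
    unfolding \<kappa>_def
    by (rule computable_nary_Least2[OF _ ex_\<kappa>])
      (intro decidable_nary_intros rational_nary_intros rational_nary_comp1[OF rational_reservoir]
        rational_nary_comp1[OF p(1)] computable_nary_comp1[OF computable_N] computable_nary_intros; simp)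
  have "rational_nary 1 (\<lambda>xs. G (xs ! 0))"
    unfolding G_def
    by (rule rational_nary_rec) (intro rational_nary_intros computable_\<kappa> computable_nary_intros; simp)
  then obtain c where c: "computable_nary 1 c" "\<And>xs. length xs = 1 \<Longrightarrow> G (xs ! 0) = decode_rational (c xs)"
    by (rule rational_nary_code) blast
  have "computable_nary 1 (\<lambda>xs. \<kappa> (xs ! 0) (decode_rational (c xs)))"
    by (rule computable_nary_comp2[OF computable_\<kappa> computable_nary_proj c(1)]) simp
  then have computable_g: "computable g"
    unfolding computable_iff_nary g_def by (rule computable_nary_cong) (simp add: c(2))

  have N: "Y (Suc t) \<le> q (N t)" "0 < p (N t)" for t
    using LeastI_ex[OF ex_N[of t]] by (simp_all add: N_def)
  have N_mono: "N t \<le> N (Suc t)" for t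
  proof -
    have "Y (Suc t) \<le> Y (Suc (Suc t))" by (simp add: Y_def)
    then show ?thesis
      unfolding N_def[of t] using N[of "Suc t"] by (intro Least_le) auto
  qed
  have G_Suc: "G (Suc t) = G t + 1 / 2 ^ g t" for t
    by (simp add: G_def g_def)
  have g: "1 / 2 ^ g t \<le> reservoir f (Suc t)" "G t + 1 / 2 ^ g t < p (N t)" if "G t < p (N t)" for t
    using LeastI_ex[OF ex_\<kappa>[of t "G t"]] that by (simp_all add: \<kappa>_def g_def)
  have G_less: "G t < p (N t)" for t
  proof (induction t)
    case 0
    then show ?case using N by (simp add: G_def)
  next
    case (Suc t)
    then have "G (Suc t) < p (N t)" using g(2) by (simp add: G_Suc)
    also have "\<dots> \<le> p (N (Suc t))" by (intro monoD[OF p(2)] N_mono)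
    finally show ?case .
  qed
  have gap: "x - G t \<le> (y - Y t + reservoir f t) / 2" for t
  proof (induction t)
    case 0
    then show ?case using x by (simp add: G_def Y_def reservoir_0)
  next
    case (Suc t)
    \<comment> \<open>As the reservoir stays below \<open>1\<close>, the exponent \<open>g t\<close> has a predecessor, which fails one of the two
      conditions: twice the chosen term exceeds the payout, or it would reach \<open>p (N t)\<close>.\<close>
    have "g t \<noteq> 0"
      using g(1)[OF G_less, of t] reservoir_less_1[of f "Suc t"] by (intro notI) simp
    then obtain k where k: "g t = Suc k" using not0_implies_Suc by blast
    then have pow_k: "1 / 2 ^ k = 2 * (1 / 2 ^ g t :: real)" by simp
    have "\<not> (1 / 2 ^ k \<le> reservoir f (Suc t) \<and> G t + 1 / 2 ^ k < p (N t))"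
      using not_less_Least[of k "\<lambda>k. (1 / 2 ^ k \<le> reservoir f (Suc t) \<and> G t + 1 / 2 ^ k < p (N t)) \<or> p (N t) \<le> G t"]
      unfolding \<kappa>_def[symmetric] g_def[symmetric] using k by simp
    then consider "reservoir f (Suc t) < 2 * (1 / 2 ^ g t)"
      | "2 * (1 / 2 ^ g t) \<le> reservoir f (Suc t)" "p (N t) \<le> G t + 2 * (1 / 2 ^ g t)"
      using pow_k by (metis not_less)
    then show ?case
    proof cases
      \<comment> \<open>More than half of the payout is used, which is what the bound on the gap loses at this time.\<close>
      case 1
      have "x - (G t + u) \<le> (y - (Y t + v) + r') / 2"
        if "r' < 2 * u" "x - G t \<le> (y - Y t + r) / 2" "2 * r' = r + v" for r r' u v
        using that by (simp add: field_simps)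
      from this[OF 1 Suc] show ?thesis
        by (simp add: G_Suc Y_def reservoir_Suc)
    next
      \<comment> \<open>What is missing to \<open>p (N t)\<close> is at most one more term of the chosen size, hence at most half of
        the content of the reservoir.\<close>
      case 2
      have "x - p (N t) \<le> (y - Y (Suc t)) / 2"
        using close[of "N t"] N(1)[of t] by (simp add: field_simps)
      then show ?thesis
        using 2 by (simp add: G_Suc)
    qed
  qed
  have "G \<longlonglongrightarrow> x"
  proof (rule tendsto_sandwich)
    have "(\<lambda>t. x - (y - Y t + reservoir f t) / 2) \<longlonglongrightarrow> x - (y - y + 0) / 2"
      using f(2) reservoir_tendsto_0[OF f(2)] unfolding is_name_def sums_def Y_def
      by (intro tendsto_intros) auto
    then show "(\<lambda>t. x - (y - Y t + reservoir f t) / 2) \<longlonglongrightarrow> x" by simp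
    show "eventually (\<lambda>t. x - (y - Y t + reservoir f t) / 2 \<le> G t) sequentially"
    proof (intro always_eventually allI)
      fix t show "x - (y - Y t + reservoir f t) / 2 \<le> G t"
        using gap[of t] by linarith
    qed
    show "eventually (\<lambda>t. G t \<le> x) sequentially"
      by (intro always_eventually allI less_imp_le less_trans[OF G_less p(4)])
  qed simp
  moreover have "G = (\<lambda>t. \<Sum>i<t. 1 / 2 ^ g i)"
  proof
    fix t show "G t = (\<Sum>i<t. 1 / 2 ^ g i)"
      by (induction t) (simp_all add: G_Suc, simp add: G_def)
  qed
  ultimately have "is_name g x"
    unfolding is_name_def sums_def by simp
  from that[OF computable_g this g(1)[OF G_less]] show ?thesis .
qed

text \<open>
  Truncated subtraction of the two numerators does the cutting off at zero.
\<close>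

lemma rational_nary_nonneg_part:
  assumes "computable_rat_seq q"
  shows "rational_nary 1 (\<lambda>xs. max 0 (real_of_rat (q (xs ! 0))))"
proof -
  obtain a b d where abd: "computable a" "computable b" "computable d"
      "\<And>n. d n > 0 \<and> q n = (of_nat (a n) - of_nat (b n)) / of_nat (d n)"
    using assms unfolding computable_rat_seq_def by blast
  show ?thesis
  proof (rule rational_naryI)
    show "computable_nary 1 (\<lambda>xs. a (xs ! 0) - b (xs ! 0))" "computable_nary 1 (\<lambda>xs. d (xs ! 0))"
      using abd(1-3) unfolding computable_iff_nary by (simp_all add: computable_nary_diff)
    fix xs :: "nat list"
    have "real_of_rat (q n) = (real (a n) - real (b n)) / real (d n)" for n
      using abd(4)[of n] by (simp add: of_rat_divide of_rat_diff)
    moreover have "max 0 ((real (a n) - real (b n)) / real (d n)) = real (a n - b n) / real (d n)" for n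
      using abd(4)[of n] by (cases "b n \<le> a n") (auto simp: max_def of_nat_diff field_simps)
    ultimately show "0 < d (xs ! 0) \<and> max 0 (real_of_rat (q (xs ! 0))) = real (a (xs ! 0) - b (xs ! 0)) / real (d (xs ! 0))"
      using abd(4) by simp
  qed
qed

section \<open>Downward closure under Solovay reducibility\<close>

theorem theorem20:
  fixes x y :: real
  assumes "x > 0" and "y > 0"
    and "left_computable x" and "left_computable y"
    and "x \<le>\<^sub>S y"
    and "reordered_computable y"
  shows "reordered_computable x"
proof -
  obtain f where f: "computable f" "is_name f y"
      "series_converges_computably (\<lambda>k. real (multiplicity_fn f k) * (1 / 2 ^ k))"
    using assms(6) unfolding reordered_computable_def by blast
  obtain s where s: "computable s" "tail_modulus f s"
    using tail_modulus_if_converges[OF f(2,3)] by blast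
  obtain p q c where p: "left_approx p x" and q: "left_approx q y"
    and c: "c > 0" "\<And>n. x - real_of_rat (p n) \<le> c * (y - real_of_rat (q n))"
    using assms(5) unfolding solovay_reducible_def by blast
  \<comment> \<open>The exponent is large enough to bring the constant \<open>c\<close> below \<open>1/2\<close> and also \<open>x\<close> below half of
    \<open>y\<close>, which is the invariant of the construction at time \<open>0\<close>.\<close>
  obtain e where e: "max (2 * c) (2 * x / y) < 2 ^ e"
    using real_arch_pow[of 2 "max (2 * c) (2 * x / y)"] by auto
  obtain b where b: "y < 2 ^ b"
    using real_arch_pow[of 2 y] by auto
  have x_le: "x / 2 ^ e \<le> y / 2"
    using e assms(2) by (simp add: field_simps)
  define P where "P n = max 0 (real_of_rat (p n)) / 2 ^ e" for n
  define Q where "Q n = max 0 (real_of_rat (q n))" for n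
  have limits: "(\<lambda>n. real_of_rat (p n)) \<longlonglongrightarrow> x" "(\<lambda>n. real_of_rat (q n)) \<longlonglongrightarrow> y"
    using p q unfolding left_approx_def by auto
  have mono: "real_of_rat (p m) \<le> real_of_rat (p n)" if "m \<le> n" for m n
    using p that unfolding left_approx_def by (simp add: of_rat_less_eq strict_mono_less_eq)
  have p_less: "real_of_rat (p n) < x" for n
  proof -
    have "real_of_rat (p n) < real_of_rat (p (Suc n))"
      using p unfolding left_approx_def by (simp add: of_rat_less strict_mono_less)
    also have "\<dots> \<le> x"
      by (rule incseq_le[OF _ limits(1)]) (auto simp: mono_def intro: mono)
    finally show ?thesis .
  qed
  have q_le: "real_of_rat (q n) \<le> y" for n
  proof (rule incseq_le[OF _ limits(2)])
    show "incseq (\<lambda>n. real_of_rat (q n))"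
      using q unfolding left_approx_def by (auto simp: mono_def of_rat_less_eq strict_mono_less_eq)
  qed
  have "reordered_computable (x / 2 ^ e)"
  proof (rule greedy_name[of P "x / 2 ^ e" Q y f])
    show "rational_nary 1 (\<lambda>xs. P (xs ! 0))" "rational_nary 1 (\<lambda>xs. Q (xs ! 0))"
      unfolding P_def Q_def using p q unfolding left_approx_def
      by (intro rational_nary_divide_2_power rational_nary_nonneg_part; simp)+
    show "mono P"
      unfolding P_def mono_def
      by (intro allI impI divide_right_mono max.mono mono) auto
    have "(\<lambda>n. max 0 (real_of_rat (p n)) / 2 ^ e) \<longlonglongrightarrow> max 0 x / 2 ^ e"
      by (intro tendsto_intros limits) auto
    then show "P \<longlonglongrightarrow> x / 2 ^ e"
      using assms(1) by (simp add: P_def[abs_def])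
    show "P n < x / 2 ^ e" for n
      using p_less[of n] assms(1) by (simp add: P_def divide_strict_right_mono)
    have "(\<lambda>n. max 0 (real_of_rat (q n))) \<longlonglongrightarrow> max 0 y"
      by (intro tendsto_intros limits)
    then show "Q \<longlonglongrightarrow> y"
      using assms(2) by (simp add: Q_def[abs_def])
    show "x / 2 ^ e - P n \<le> (y - Q n) / 2" for n
    proof (cases "real_of_rat (q n) \<le> 0")
      \<comment> \<open>Where \<open>q n\<close> is cut off at zero, the bound is the one on \<open>x\<close> itself.\<close>
      case True
      have "0 \<le> P n" by (simp add: P_def)
      then show ?thesis using True x_le by (simp add: Q_def)
    next
      case False
      have "x / 2 ^ e - P n \<le> (x - real_of_rat (p n)) / 2 ^ e"
        unfolding P_def diff_divide_distrib by (simp add: divide_right_mono)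
      also have "\<dots> \<le> c * (y - real_of_rat (q n)) / 2 ^ e"
        by (intro divide_right_mono c) simp
      also have "\<dots> \<le> (2 ^ e / 2) * (y - real_of_rat (q n)) / 2 ^ e"
        using e q_le[of n] by (intro divide_right_mono mult_right_mono) auto
      finally show ?thesis using False by (simp add: Q_def)
    qed
  next
    fix g assume g: "computable g" "is_name g (x / 2 ^ e)" "\<And>t. 1 / 2 ^ g t \<le> reservoir f (Suc t)"
    have "computable (\<lambda>n. 2 * (n + 3 + s (Suc n) + b))"
      unfolding computable_iff_nary
      by (intro computable_nary_intros computable_nary_computable[OF s(1)]; simp)
    moreover have "tail_modulus g (\<lambda>n. 2 * (n + 3 + s (Suc n) + b))"
      using tail_modulus_if_below_reservoir[OF f(2) s(2) _ g(3)] b by simp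
    ultimately show ?thesis
      using g(1,2) reordered_computable_if_tail_modulus by blast
  qed (use f x_le assms in auto)
  then show ?thesis by (rule reordered_computable_mult_2_power)
qed

end
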